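(* Let $K_{r_1,r_2,\dots,r_k}$ be a complete $k$-partite graph, where $2\leq k<n=r_1+\dots+r_k$ and $r_1\geq r_2\geq\dots\geq r_k$. Then $$\mathrm{gp}(\mathcal{M}(K_{r_1,r_2,\dots,r_k}))=\max\{n,2r_1\}.$$
   Context: $K_{r_1,\dots,r_k}$ denotes the complete $k$-partite graph with partite sets of (positive) sizes $r_1,\dots,r_k$. A set $S$ of vertices of a graph $H$ is a general position set if no shortest path in $H$ contains three or more vertices of $S$; $\mathrm{gp}(H)$ is the number of vertices in a largest general position set of $H$. The Mycielskian $\mathcal{M}(G)$ of a graph $G$ with vertex set $V$ and edge set $E$ has vertex set $V\cup V'\cup\{u^*\}$, where $V'=\{u' : u\in V\}$ is a disjoint copy of $V$ and $u^*$ is an additional vertex (the root), and edge set $E\cup\{uv' : uv\in E\}\cup\{v'u^* : v'\in V'\}$ (for each edge $uv\in E$ both $uv'$ and $vu'$ are included). *)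

theory Defs
  imports "Graph_Theory.Graph_Theory" "HOL-Library.Disjoint_Sets"
begin

text \<open>
  Finite simple undirected graphs are represented, as in \<^theory>\<open>Graph_Theory.Kuratowski\<close>, by
  symmetric loopfree digraphs: an undirected edge is a pair of opposite arcs.  The complete
  multipartite graph is only determined up to isomorphism, hence it is given by a predicate,
  following the library's \<^const>\<open>complete_bipartite_digraph\<close>.
\<close>

definition complete_multipartite_digraph ::
    "nat \<Rightarrow> (nat \<Rightarrow> nat) \<Rightarrow> ('a, 'b) pre_digraph \<Rightarrow> bool" where
  "complete_multipartite_digraph k r G \<longleftrightarrow> graph G \<and>
    (\<exists>P. disjoint_family_on P {1..k} \<and> verts G = (\<Union>i\<in>{1..k}. P i)
       \<and> (\<forall>i\<in>{1..k}. card (P i) = r i)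
       \<and> arcs_ends G = (\<Union>i\<in>{1..k}. \<Union>j\<in>{1..k} - {i}. P i \<times> P j))"

datatype 'a mycielskian_vertex = Orig 'a | Copy 'a | Root

text \<open>
  Each undirected edge \<open>uv\<close> of \<open>G\<close> occurs in \<^term>\<open>parcs G\<close> in both orientations, so
  the second and third sets together contain both orientations of both \<open>uv'\<close> and \<open>vu'\<close>.
\<close>

definition mycielskian :: "'a pair_pre_digraph \<Rightarrow> 'a mycielskian_vertex pair_pre_digraph" where
  "mycielskian G = \<lparr>
     pverts = Orig ` pverts G \<union> Copy ` pverts G \<union> {Root},
     parcs = {(Orig u, Orig v) | u v. (u, v) \<in> parcs G}
       \<union> {(Orig u, Copy v) | u v. (u, v) \<in> parcs G}
       \<union> {(Copy u, Orig v) | u v. (u, v) \<in> parcs G}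
       \<union> {(Copy v, Root) | v. v \<in> pverts G}
       \<union> {(Root, Copy v) | v. v \<in> pverts G}\<rparr>"

definition shortest_vpath :: "'a vwalk \<Rightarrow> ('a, 'b) pre_digraph \<Rightarrow> bool" where
  "shortest_vpath p H \<longleftrightarrow> vpath p H \<and>
    (\<forall>q. vpath q H \<and> hd q = hd p \<and> last q = last p \<longrightarrow> vwalk_length p \<le> vwalk_length q)"

definition general_position :: "'a set \<Rightarrow> ('a, 'b) pre_digraph \<Rightarrow> bool" where
  "general_position S H \<longleftrightarrow> S \<subseteq> verts H \<and>
    \<not> (\<exists>p. shortest_vpath p H \<and> 3 \<le> card (set p \<inter> S))"

text \<open>Meaningful for finite graphs, where the set of cardinalities is finite and contains 0.\<close>

definition gp_number :: "('a, 'b) pre_digraph \<Rightarrow> nat" where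
  "gp_number H = Max {card S | S. general_position S H}"

lemma pair_graph_mycielskian:
  assumes "pair_graph G"
  shows "pair_graph (mycielskian G)"
proof -
  interpret pair_graph G by fact
  have sym: "(v, u) \<in> parcs G" if "(u, v) \<in> parcs G" for u v
    using that pair_sym_arcs by (auto simp: symmetric_def dest: symD)
  have wf: "u \<in> pverts G \<and> v \<in> pverts G" if "(u, v) \<in> parcs G" for u v
    using that by (auto dest: wellformed')
  have irr: "(u, u) \<notin> parcs G" for u
    using pair_no_loops[of "(u, u)"] by auto
  let ?V = "pverts (mycielskian G)" and ?A = "parcs (mycielskian G)"
  have fin: "finite ?V"
    using pair_finite_verts by (simp add: mycielskian_def)
  have sub: "?A \<subseteq> ?V \<times> ?V"
    by (auto simp: mycielskian_def dest: wf)
  have "finite ?A"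
    using finite_subset[OF sub] fin by simp
  moreover have "sym ?A"
    by (rule symI) (auto simp: mycielskian_def intro: sym)
  moreover have "(x, x) \<notin> ?A" for x
    by (auto simp: mycielskian_def irr)
  ultimately show ?thesis
    using fin sub
    by unfold_locales (auto simp: symmetric_def)
qed

lemma complete_multipartite_digraph_exists:
  "\<exists>G :: (nat \<times> nat) pair_pre_digraph. complete_multipartite_digraph k r (with_proj G)"
proof -
  define P where "P i = {i} \<times> {..<r i}" for i
  define G where "G = \<lparr>pverts = (\<Union>i\<in>{1..k}. P i),
    parcs = (\<Union>i\<in>{1..k}. \<Union>j\<in>{1..k} - {i}. P i \<times> P j)\<rparr>"
  have "pair_graph G"
    by unfold_locales (auto simp: G_def P_def symmetric_def intro!: symI)
  then interpret pair_graph G .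
  have "graph (with_proj G)" by unfold_locales
  then show ?thesis
    unfolding complete_multipartite_digraph_def
    by (intro exI[of _ G] conjI exI[of _ P])
      (auto simp: G_def P_def disjoint_family_on_def)
qed

end

theory Submission
  imports Defs
begin

text \<open>
  The Mycielskian of a complete multipartite graph has diameter two: two non-adjacent vertices of
  \<open>G\<close> (or a vertex and its own copy) lie in the same part and are joined through any
  vertex of another part, and two copies are joined through the root.  In a graph of diameter two
  the only shortest paths on three or more vertices are the induced paths \<open>x y z\<close>, so a set is
  in general position exactly if adjacency, restricted to distinct elements of the set, is transitive,
  that is, if it induces a disjoint union of cliques (\<open>general_position_diameter_two\<close>).

  It remains to maximise the size of such a set \<open>S\<close>.  The set of all copies and the
  set formed by a largest part together with its copies are both independent; they have
  \<open>n\<close> and \<open>2 * r 1\<close> elements.  For the upper bound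
  (\<open>card_induced_clique_union_le\<close>), let \<open>A\<close> and \<open>B\<close> be the sets of vertices of \<open>G\<close> that
  occur in \<open>S\<close> as originals and as copies.  The originals either lie in one part or form
  a transversal clique, because two vertices of one part and one of another induce a path.
  Suppose that the root is present or that some original is adjacent to some copy in \<open>S\<close>.
  Then almost nothing else fits: \<open>S\<close> has at most \<open>r 1 + 2\<close> elements if the originals share
  a part, and at most \<open>k + 1\<close> if they do not.  Since \<open>k < n\<close> forces \<open>r 1 \<ge> 2\<close>,
  neither number exceeds the maximum of \<open>n\<close> and \<open>2 * r 1\<close>.  In the remaining case \<open>S\<close> consists of
  copies only, or of originals and copies from one part, or of a transversal clique.
\<close>

section \<open>General position in graphs of diameter two\<close>

text \<open>
  A path with three vertices \<open>x y z\<close> whose ends are not adjacent is shortest, while a shortest path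
  cannot be longer than that.
\<close>

lemma general_position_diameter_two:
  assumes "loopfree_digraph H"
    and diam: "\<And>x z. x \<in> verts H \<Longrightarrow> z \<in> verts H \<Longrightarrow> x \<noteq> z \<Longrightarrow> (x, z) \<notin> arcs_ends H \<Longrightarrow>
      \<exists>y. (x, y) \<in> arcs_ends H \<and> (y, z) \<in> arcs_ends H"
  shows "general_position S H \<longleftrightarrow> S \<subseteq> verts H \<and>
    (\<forall>x\<in>S. \<forall>y\<in>S. \<forall>z\<in>S. (x, y) \<in> arcs_ends H \<and> (y, z) \<in> arcs_ends H \<and> x \<noteq> z
      \<longrightarrow> (x, z) \<in> arcs_ends H)"
proof -
  interpret loopfree_digraph H by fact
  let ?A = "arcs_ends H"
  let ?trans = "\<forall>x\<in>S. \<forall>y\<in>S. \<forall>z\<in>S. (x, y) \<in> ?A \<and> (y, z) \<in> ?A \<and> x \<noteq> z \<longrightarrow> (x, z) \<in> ?A"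
  have wf: "x \<in> verts H" "y \<in> verts H" "x \<noteq> y" if "(x, y) \<in> ?A" for x y
    using adj_in_verts[OF that] adj_not_same[of x] that by auto
  have vpath2: "vpath [x, y] H" if "(x, y) \<in> ?A" for x y
    using wf[OF that] that by (simp add: vpath_def vwalk_def)
  have vpath3: "vpath [x, y, z] H" if "(x, y) \<in> ?A" "(y, z) \<in> ?A" "x \<noteq> z" for x y z
    using wf[OF that(1)] wf[OF that(2)] that by (simp add: vpath_def vwalk_def)
  have short: False if p: "shortest_vpath p H" and c: "3 \<le> card (set p \<inter> S)" and ?trans for p
  proof -
    have path: "vpath p H" and min: "\<And>q. vpath q H \<Longrightarrow> hd q = hd p \<Longrightarrow> last q = last p
        \<Longrightarrow> length p - 1 \<le> length q - 1"
      using p by (simp_all add: shortest_vpath_def)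
    then have ne: "p \<noteq> []" and d: "distinct p" and sub: "set p \<subseteq> verts H"
      by (simp_all add: vpath_def vwalk_def)
    have l3: "3 \<le> length p"
      using c card_mono[of "set p" "set p \<inter> S"] card_length[of p] by simp
    define x z where "x = hd p" and "z = last p"
    have xz: "x \<noteq> z"
      using l3 d hd_in_set[of p] unfolding x_def z_def
      by (cases p; cases "tl p") (simp_all, metis last_in_set list.discI)
    have na: "(x, z) \<notin> ?A"
      using min[OF vpath2[of x z]] l3 x_def z_def by auto
    have "x \<in> verts H" "z \<in> verts H" using ne sub by (auto simp: x_def z_def)
    then obtain y where "(x, y) \<in> ?A" "(y, z) \<in> ?A"
      using diam xz na by blast
    from min[OF vpath3[OF this xz]] have l: "length p = 3" using l3 by (simp add: x_def z_def)
    then obtain a b e where abe: "p = [a, b, e]"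
      by (auto simp: numeral_3_eq_3 length_Suc_conv)
    have "card (set p) = 3" using d l by (simp add: distinct_card)
    then have "set p \<inter> S = set p"
      using c by (intro card_seteq) simp_all
    then have "a \<in> S" "b \<in> S" "e \<in> S" using abe by auto
    moreover have "(a, b) \<in> ?A" "(b, e) \<in> ?A"
      using path abe by (simp_all add: vpath_def vwalk_def)
    moreover have "a = x" "e = z" using abe by (simp_all add: x_def z_def)
    ultimately show False using \<open>?trans\<close> xz na by blast
  qed
  have long: "\<exists>p. shortest_vpath p H \<and> 3 \<le> card (set p \<inter> S)"
    if "x \<in> S" "y \<in> S" "z \<in> S" and xy: "(x, y) \<in> ?A" and yz: "(y, z) \<in> ?A"
      and xz: "x \<noteq> z" and na: "(x, z) \<notin> ?A" for x y z
  proof (intro exI conjI)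
    have "set [x, y, z] \<inter> S = {x, y, z}" using that(1-3) by auto
    then show "3 \<le> card (set [x, y, z] \<inter> S)"
      using wf(3)[OF xy] wf(3)[OF yz] xz by simp
    have "2 \<le> length q - 1" if q: "vpath q H" "hd q = x" "last q = z" for q
    proof (rule ccontr)
      assume "\<not> 2 \<le> length q - 1"
      then have "length q = 0 \<or> length q = Suc 0 \<or> length q = Suc (Suc 0)" by linarith
      then consider "q = []" | a where "q = [a]" | a b where "q = [a, b]"
        unfolding length_Suc_conv length_0_conv by blast
      then show False
        using q xz na by cases (simp_all add: vpath_def vwalk_def)
    qed
    then show "shortest_vpath [x, y, z] H"
      using vpath3[OF xy yz xz] by (auto simp: shortest_vpath_def numeral_2_eq_2)
  qed
  show ?thesis
    unfolding general_position_def using short long by blast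
qed

section \<open>Adjacency in the Mycielskian\<close>

lemma pverts_mycielskian_iff [simp]:
  "Orig u \<in> pverts (mycielskian G) \<longleftrightarrow> u \<in> pverts G"
  "Copy u \<in> pverts (mycielskian G) \<longleftrightarrow> u \<in> pverts G"
  "Root \<in> pverts (mycielskian G)"
  by (auto simp: mycielskian_def)

lemma parcs_mycielskian_iff [simp]:
  "(Orig u, Orig v) \<in> parcs (mycielskian G) \<longleftrightarrow> (u, v) \<in> parcs G"
  "(Orig u, Copy v) \<in> parcs (mycielskian G) \<longleftrightarrow> (u, v) \<in> parcs G"
  "(Copy u, Orig v) \<in> parcs (mycielskian G) \<longleftrightarrow> (u, v) \<in> parcs G"
  "(Copy u, Copy v) \<notin> parcs (mycielskian G)"
  "(Copy u, Root) \<in> parcs (mycielskian G) \<longleftrightarrow> u \<in> pverts G"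
  "(Root, Copy u) \<in> parcs (mycielskian G) \<longleftrightarrow> u \<in> pverts G"
  "(Orig u, Root) \<notin> parcs (mycielskian G)"
  "(Root, Orig u) \<notin> parcs (mycielskian G)"
  "(Root, Root) \<notin> parcs (mycielskian G)"
  by (auto simp: mycielskian_def)

text \<open>
  The case \<open>u = v\<close> of the assumption is needed twice: for a vertex and its own copy,
  and, since it excludes isolated vertices, for a vertex of \<open>G\<close> and the root.
\<close>

lemma mycielskian_diameter_two:
  assumes "pair_graph G"
    and common: "\<And>u v. u \<in> pverts G \<Longrightarrow> v \<in> pverts G \<Longrightarrow> (u, v) \<notin> parcs G \<Longrightarrow>
      \<exists>w. (u, w) \<in> parcs G \<and> (w, v) \<in> parcs G"
    and "x \<in> pverts (mycielskian G)" "z \<in> pverts (mycielskian G)" "x \<noteq> z"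
    and "(x, z) \<notin> parcs (mycielskian G)"
  shows "\<exists>y. (x, y) \<in> parcs (mycielskian G) \<and> (y, z) \<in> parcs (mycielskian G)"
proof -
  interpret pair_graph G by fact
  have nbr: "\<exists>w. (u, w) \<in> parcs G \<and> (w, u) \<in> parcs G" if "u \<in> pverts G" for u
    using common[OF that that] pair_no_loops[of "(u, u)"] by auto
  show ?thesis
  proof (cases x; cases z)
    fix u v assume "x = Orig u" "z = Orig v"
    then obtain w where "(u, w) \<in> parcs G" "(w, v) \<in> parcs G"
      using assms(3,4,6) common[of u v] by auto
    then show ?thesis using \<open>x = _\<close> \<open>z = _\<close> by (intro exI[of _ "Orig w"]) simp
  next
    fix u v assume "x = Orig u" "z = Copy v"
    then obtain w where "(u, w) \<in> parcs G" "(w, v) \<in> parcs G"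
      using assms(3,4,6) common[of u v] by auto
    then show ?thesis using \<open>x = _\<close> \<open>z = _\<close> by (intro exI[of _ "Orig w"]) simp
  next
    fix u v assume "x = Copy u" "z = Orig v"
    then obtain w where "(u, w) \<in> parcs G" "(w, v) \<in> parcs G"
      using assms(3,4,6) common[of u v] by auto
    then show ?thesis using \<open>x = _\<close> \<open>z = _\<close> by (intro exI[of _ "Orig w"]) simp
  next
    fix u v assume "x = Copy u" "z = Copy v"
    then show ?thesis using assms(3,4) by (intro exI[of _ Root]) simp
  next
    fix u assume "x = Orig u" "z = Root"
    then obtain w where "(u, w) \<in> parcs G" using assms(3) nbr[of u] by auto
    then show ?thesis
      using \<open>x = _\<close> \<open>z = _\<close> wellformed' by (intro exI[of _ "Copy w"]) simp
  next
    fix u assume "x = Root" "z = Orig u"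
    then obtain w where "(w, u) \<in> parcs G" using assms(4) nbr[of u] by auto
    then show ?thesis
      using \<open>x = _\<close> \<open>z = _\<close> wellformed' by (intro exI[of _ "Copy w"]) simp
  qed (use assms(3-6) in auto)
qed

section \<open>Complete multipartite graphs\<close>

text \<open>
  The partition is given by the function \<open>c\<close> that names the part of each vertex.  Adjacency then
  is inequality of colours, so that the arguments about induced paths need no set algebra.
\<close>

locale complete_multipartite = pair_graph G for G :: "'a pair_pre_digraph" +
  fixes c :: "'a \<Rightarrow> 'c"
  assumes arc_iff: "(u, v) \<in> parcs G \<longleftrightarrow> u \<in> pverts G \<and> v \<in> pverts G \<and> c u \<noteq> c v"
begin

abbreviation part :: "'c \<Rightarrow> 'a set" where
  "part i \<equiv> {u \<in> pverts G. c u = i}"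

lemma general_position_mycielskian_iff:
  assumes "2 \<le> card (c ` pverts G)"
  shows "general_position S (with_proj (mycielskian G)) \<longleftrightarrow> S \<subseteq> pverts (mycielskian G) \<and>
    (\<forall>x\<in>S. \<forall>y\<in>S. \<forall>z\<in>S. (x, y) \<in> parcs (mycielskian G) \<and> (y, z) \<in> parcs (mycielskian G) \<and> x \<noteq> z
      \<longrightarrow> (x, z) \<in> parcs (mycielskian G))"
proof -
  interpret M: pair_graph "mycielskian G"
    by (rule pair_graph_mycielskian) (rule pair_graph)
  have "\<exists>w. (u, w) \<in> parcs G \<and> (w, v) \<in> parcs G"
    if "u \<in> pverts G" "v \<in> pverts G" "(u, v) \<notin> parcs G" for u v
  proof -
    have "\<not> c ` pverts G \<subseteq> {c u}"
    proof
      assume "c ` pverts G \<subseteq> {c u}"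
      from card_mono[OF _ this] show False using assms by simp
    qed
    then obtain w where "w \<in> pverts G" "c w \<noteq> c u" by blast
    moreover have "c u = c v" using that by (simp add: arc_iff)
    ultimately show ?thesis using that by (intro exI[of _ w]) (simp add: arc_iff)
  qed
  then have "\<exists>y. (x, y) \<in> parcs (mycielskian G) \<and> (y, z) \<in> parcs (mycielskian G)"
    if "x \<in> pverts (mycielskian G)" "z \<in> pverts (mycielskian G)" "x \<noteq> z"
      "(x, z) \<notin> parcs (mycielskian G)" for x z
    by (rule mycielskian_diameter_two[OF pair_graph _ that])
  then show ?thesis
    by (rule general_position_diameter_two[OF M.loopfree_digraph_axioms, of S,
          unfolded with_proj_simps])
qed

text \<open>
  Independent sets are in general position; these two kinds are the extremal ones.
\<close>

lemma general_position_copies: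
  assumes "2 \<le> card (c ` pverts G)"
  shows "general_position (Copy ` pverts G) (with_proj (mycielskian G))"
  unfolding general_position_mycielskian_iff[OF assms] by (auto simp: image_iff)

lemma general_position_doubled_part:
  assumes "2 \<le> card (c ` pverts G)"
  shows "general_position (Orig ` part i \<union> Copy ` part i) (with_proj (mycielskian G))"
  unfolding general_position_mycielskian_iff[OF assms] by (auto simp: arc_iff)

lemma card_doubled_part: "card (Orig ` part i \<union> Copy ` part i) = 2 * card (part i)"
proof -
  have "finite (part i)" using pair_finite_verts by simp
  then have "card (Orig ` part i \<union> Copy ` part i) = card (Orig ` part i) + card (Copy ` part i)"
    by (intro card_Un_disjoint) auto
  also have "card (Orig ` part i) = card (part i)" by (rule card_image) (simp add: inj_on_def)
  also have "card (Copy ` part i) = card (part i)" by (rule card_image) (simp add: inj_on_def)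
  finally show ?thesis by simp
qed

lemma card_rainbow_le:
  assumes "A \<subseteq> pverts G" "inj_on c A"
  shows "card A \<le> card (c ` pverts G)"
proof -
  have "card (c ` A) \<le> card (c ` pverts G)"
    using assms(1) pair_finite_verts by (intro card_mono image_mono) auto
  then show ?thesis using card_image[OF assms(2)] by simp
qed

text \<open>
  If adjacency is transitive on the distinct elements of \<open>A\<close>, two vertices of one colour exclude all
  other colours.
\<close>

lemma monochromatic_or_rainbow:
  assumes "\<And>u v w. u \<in> A \<Longrightarrow> v \<in> A \<Longrightarrow> w \<in> A \<Longrightarrow> c u = c v \<Longrightarrow> c u \<noteq> c w \<Longrightarrow> u = v"
  shows "(\<exists>i. \<forall>u\<in>A. c u = i) \<or> inj_on c A \<and> (\<forall>b. \<exists>u\<in>A. c u \<noteq> b)"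
proof (cases "\<exists>i. \<forall>u\<in>A. c u = i")
  case False
  then have other: "\<forall>b. \<exists>u\<in>A. c u \<noteq> b" by blast
  have "inj_on c A"
  proof (rule inj_onI)
    fix u v assume "u \<in> A" "v \<in> A" "c u = c v"
    moreover obtain w where "w \<in> A" "c w \<noteq> c u" using other by blast
    ultimately show "u = v" using assms[of u v w] by simp
  qed
  then show ?thesis using other by blast
qed simp

text \<open>
  The first assumption, that there are fewer parts than vertices, leaves room for the root next to a
  transversal clique; \<open>2 \<le> m\<close> leaves room for two extra vertices next to a single part.
\<close>

lemma card_induced_clique_union_le:
  assumes k: "card (c ` pverts G) < card (pverts G)"
    and m: "\<And>i. card (part i) \<le> m" "2 \<le> m"
    and S: "S \<subseteq> pverts (mycielskian G)"
    and trans: "\<And>x y z. x \<in> S \<Longrightarrow> y \<in> S \<Longrightarrow> z \<in> S \<Longrightarrow> (x, y) \<in> parcs (mycielskian G) \<Longrightarrow>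
      (y, z) \<in> parcs (mycielskian G) \<Longrightarrow> x \<noteq> z \<Longrightarrow> (x, z) \<in> parcs (mycielskian G)"
  shows "card S \<le> max (card (pverts G)) (2 * m)"
proof -
  define A where "A = {u. Orig u \<in> S}"
  define B where "B = {u. Copy u \<in> S}"
  have AV: "A \<subseteq> pverts G" and BV: "B \<subseteq> pverts G"
    using S by (auto simp: A_def B_def)
  have fin: "finite A" "finite B"
    by (rule finite_subset[OF AV pair_finite_verts], rule finite_subset[OF BV pair_finite_verts])
  have "S = Orig ` A \<union> Copy ` B \<union> (S \<inter> {Root})"
  proof (rule set_eqI)
    show "x \<in> S \<longleftrightarrow> x \<in> Orig ` A \<union> Copy ` B \<union> (S \<inter> {Root})" for x
      by (cases x) (auto simp: A_def B_def)
  qed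
  then have "card S \<le> card (Orig ` A) + card (Copy ` B) + card (S \<inter> {Root})"
    using card_Un_le[of "Orig ` A \<union> Copy ` B" "S \<inter> {Root}"] card_Un_le[of "Orig ` A" "Copy ` B"]
    by simp
  then have cS: "card S \<le> card A + card B + card (S \<inter> {Root})"
    by (simp add: card_image inj_on_def)
  have card_le_m: "card X \<le> m" if "X \<subseteq> pverts G" "\<And>u. u \<in> X \<Longrightarrow> c u = i" for X i
  proof -
    have "card X \<le> card (part i)" using that pair_finite_verts by (intro card_mono) auto
    then show ?thesis using m(1)[of i] by simp
  qed
  \<comment> \<open>Each of the following facts forbids one kind of induced path on three vertices.\<close>
  have OOO: "u = v" if "u \<in> A" "v \<in> A" "w \<in> A" "c u = c v" "c u \<noteq> c w" for u v w
    using trans[of "Orig u" "Orig w" "Orig v"] that AV by (auto simp: A_def arc_iff)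
  have OOC: "c u \<noteq> c b" if "u \<in> A" "w \<in> A" "b \<in> B" "c u \<noteq> c w" "c w \<noteq> c b" for u w b
    using trans[of "Orig u" "Orig w" "Copy b"] that AV BV by (auto simp: A_def B_def arc_iff)
  have COC: "b = d" if "a \<in> A" "b \<in> B" "d \<in> B" "c a \<noteq> c b" "c a \<noteq> c d" for a b d
    using trans[of "Copy b" "Orig a" "Copy d"] that AV BV by (auto simp: A_def B_def arc_iff)
  have OCO: "u = v" if "b \<in> B" "u \<in> A" "v \<in> A" "c u \<noteq> c b" "c u = c v" for b u v
    using trans[of "Orig u" "Copy b" "Orig v"] that AV BV by (auto simp: A_def B_def arc_iff)
  have CRC: "b = d" if "Root \<in> S" "b \<in> B" "d \<in> B" for b d
    using trans[of "Copy b" Root "Copy d"] that BV by (auto simp: B_def)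
  have OCR: "c a = c b" if "Root \<in> S" "b \<in> B" "a \<in> A" for a b
    using trans[of "Orig a" "Copy b" Root] that AV BV by (auto simp: A_def B_def arc_iff)
  consider (mono) i where "\<And>u. u \<in> A \<Longrightarrow> c u = i"
    | (rainbow) "inj_on c A" "\<And>b. \<exists>u\<in>A. c u \<noteq> b"
    using monochromatic_or_rainbow[of A] OOO by metis
  note colours = this
  show ?thesis
  proof (cases "Root \<in> S")
    case True
    then have R: "card (S \<inter> {Root}) = 1" by simp
    show ?thesis
    proof (cases "B = {}")
      case True
      have "card A \<le> m \<or> card A \<le> card (c ` pverts G)"
        using colours
      proof cases
        case (mono i)
        then show ?thesis using card_le_m[OF AV] by blast
      next
        case rainbow
        then show ?thesis using card_rainbow_le[OF AV] by simp
      qed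
      then show ?thesis using cS R True k m(2) by auto
    next
      case False
      then obtain b where b: "b \<in> B" by auto
      then have "B = {b}" using CRC \<open>Root \<in> S\<close> by auto
      moreover have "card A \<le> m" using card_le_m[of A "c b"] OCR \<open>Root \<in> S\<close> b AV by auto
      ultimately show ?thesis using cS R m(2) by simp
    qed
  next
    case False
    then have c2: "card S \<le> card A + card B" using cS by simp
    from colours show ?thesis
    proof cases
      case (mono i)
      have cA: "card A \<le> m" using card_le_m[of A i] mono AV by auto
      consider (empty) "A = {}" | (inside) "B \<subseteq> part i"
        | (outside) a b where "a \<in> A" "b \<in> B" "c b \<noteq> i"
        using BV by auto
      then show ?thesis
      proof cases
        case empty
        then show ?thesis using c2 card_mono[OF pair_finite_verts BV] by simp
      next
        case inside
        then have "card B \<le> m" using card_le_m[of B i] by auto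
        then show ?thesis using c2 cA by simp
      next
        case outside
        have "u = a" if "u \<in> A" for u
          using OCO[OF outside(2) that outside(1)] mono[OF that] mono[OF outside(1)] outside(3)
          by simp
        then have "A = {a}" using outside(1) by blast
        \<comment> \<open>Two copies outside part \<open>i\<close> would be joined through \<open>a\<close>, so \<open>b\<close> is the only one.\<close>
        moreover have "c d = i" if "d \<in> B - {b}" for d
        proof (rule ccontr)
          assume "c d \<noteq> i"
          then have "b = d"
            using COC[OF outside(1,2), of d] outside(3) mono[OF outside(1)] that by simp
          then show False using that by simp
        qed
        then have "card (B - {b}) \<le> m" using BV by (intro card_le_m[of "B - {b}" i]) auto
        then have "card B \<le> Suc m" using outside(2) fin by (simp add: card_Diff_singleton)
        ultimately show ?thesis using c2 m(2) by simp
      qed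
    next
      case rainbow
      show ?thesis
      proof (cases "B = {}")
        case True
        then show ?thesis using c2 card_rainbow_le[OF AV rainbow(1)] k by simp
      next
        case False
        then obtain b where b: "b \<in> B" by auto
        \<comment> \<open>So every copy in \<open>S\<close> is adjacent to the whole clique and extends it by a new colour.\<close>
        have ne: "c u \<noteq> c b'" if "u \<in> A" "b' \<in> B" for u b'
          using rainbow(2)[of "c b'"] OOC that by metis
        obtain a where "a \<in> A" using rainbow(2) by blast
        then have "B = {b}" using COC b ne by blast
        moreover have "inj_on c (insert b A)"
        proof -
          have "c b \<notin> c ` A"
          proof
            assume "c b \<in> c ` A"
            then obtain u where "u \<in> A" "c u = c b" by auto
            then show False using ne[of u b] b by simp
          qed
          then show ?thesis using rainbow(1) by (auto simp: inj_on_insert)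
        qed
        then have "card (insert b A) \<le> card (c ` pverts G)"
          using card_rainbow_le[of "insert b A"] AV BV b by auto
        moreover have "b \<notin> A" using ne b by blast
        ultimately show ?thesis using c2 k fin by simp
      qed
    qed
  qed
qed

lemma gp_number_mycielskian:
  assumes "2 \<le> card (c ` pverts G)" "card (c ` pverts G) < card (pverts G)"
    and "\<And>j. card (part j) \<le> card (part i)" "2 \<le> card (part i)"
  shows "gp_number (with_proj (mycielskian G)) = max (card (pverts G)) (2 * card (part i))"
proof -
  let ?N = "max (card (pverts G)) (2 * card (part i))"
  let ?C = "{card S | S. general_position S (with_proj (mycielskian G))}"
  have le: "x \<le> ?N" if "x \<in> ?C" for x
  proof -
    from that obtain S where x: "x = card S"
      and "general_position S (with_proj (mycielskian G))" by auto
    then have "S \<subseteq> pverts (mycielskian G)"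
      and "\<And>x y z. x \<in> S \<Longrightarrow> y \<in> S \<Longrightarrow> z \<in> S \<Longrightarrow> (x, y) \<in> parcs (mycielskian G) \<Longrightarrow>
        (y, z) \<in> parcs (mycielskian G) \<Longrightarrow> x \<noteq> z \<Longrightarrow> (x, z) \<in> parcs (mycielskian G)"
      unfolding general_position_mycielskian_iff[OF assms(1)] by blast+
    then show ?thesis
      unfolding x by (intro card_induced_clique_union_le assms(2,3,4))
  qed
  have "card (Copy ` pverts G) = card (pverts G)" by (simp add: card_image inj_on_def)
  then have "card (pverts G) \<in> ?C" using general_position_copies[OF assms(1)] by force
  moreover have "2 * card (part i) \<in> ?C"
    using general_position_doubled_part[OF assms(1)] card_doubled_part[of i, symmetric] by blast
  ultimately have "?N \<in> ?C" unfolding max_def by presburger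
  moreover have "finite ?C" using le finite_nat_set_iff_bounded_le by blast
  ultimately show ?thesis unfolding gp_number_def using le by (intro Max_eqI)
qed

end

lemma complete_multipartite_digraphE:
  assumes "complete_multipartite_digraph k r (with_proj G)" and pos: "\<forall>i\<in>{1..k}. 0 < r i"
  obtains c where "complete_multipartite G c" "c ` pverts G = {1..k}"
    "card (pverts G) = (\<Sum>i=1..k. r i)" "\<And>i. i \<in> {1..k} \<Longrightarrow> card {u \<in> pverts G. c u = i} = r i"
proof -
  from assms obtain P where g: "graph (with_proj G)" and disj: "disjoint_family_on P {1..k}"
    and V: "pverts G = (\<Union>i\<in>{1..k}. P i)" and cP: "\<And>i. i \<in> {1..k} \<Longrightarrow> card (P i) = r i"
    and E: "parcs G = (\<Union>i\<in>{1..k}. \<Union>j\<in>{1..k} - {i}. P i \<times> P j)"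
    by (auto simp: complete_multipartite_digraph_def)
  have "\<forall>u\<in>pverts G. \<exists>i. i \<in> {1..k} \<and> u \<in> P i" unfolding V by blast
  from bchoice[OF this] obtain c where c: "\<And>u. u \<in> pverts G \<Longrightarrow> c u \<in> {1..k} \<and> u \<in> P (c u)"
    by blast
  have cI: "c u = i" if "i \<in> {1..k}" "u \<in> P i" for u i
    using c[of u] that disj V unfolding disjoint_family_on_def by blast
  have part: "{u \<in> pverts G. c u = i} = P i" if "i \<in> {1..k}" for i
    using that c cI V by blast
  have fin: "finite (P i)" "P i \<noteq> {}" if "i \<in> {1..k}" for i
    using pos cP[OF that] that by (force intro: card_ge_0_finite)+
  interpret pair_graph G by (rule pair_graphI_graph[OF g])
  show ?thesis
  proof
    show "complete_multipartite G c"
    proof unfold_locales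
      fix u v
      show "(u, v) \<in> parcs G \<longleftrightarrow> u \<in> pverts G \<and> v \<in> pverts G \<and> c u \<noteq> c v"
      proof
        assume "(u, v) \<in> parcs G"
        then obtain i j where "i \<in> {1..k}" "j \<in> {1..k}" "i \<noteq> j" "u \<in> P i" "v \<in> P j"
          unfolding E by blast
        moreover from this have "c u = i" "c v = j" using cI by simp_all
        ultimately show "u \<in> pverts G \<and> v \<in> pverts G \<and> c u \<noteq> c v" unfolding V by blast
      next
        assume "u \<in> pverts G \<and> v \<in> pverts G \<and> c u \<noteq> c v"
        then have "c u \<in> {1..k}" "c v \<in> {1..k} - {c u}" "(u, v) \<in> P (c u) \<times> P (c v)"
          using c[of u] c[of v] by simp_all
        then show "(u, v) \<in> parcs G" unfolding E by blast
      qed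
    qed
    show "c ` pverts G = {1..k}"
    proof
      show "c ` pverts G \<subseteq> {1..k}" using c by blast
      show "{1..k} \<subseteq> c ` pverts G"
      proof
        fix i assume i: "i \<in> {1..k}"
        then obtain u where "u \<in> P i" using fin by blast
        then have "u \<in> pverts G" "c u = i" using V i cI by blast+
        then show "i \<in> c ` pverts G" by blast
      qed
    qed
    show "card (pverts G) = (\<Sum>i=1..k. r i)"
      unfolding V using fin disj cP
      by (subst card_UN_disjoint) (auto simp: disjoint_family_on_def)
    show "card {u \<in> pverts G. c u = i} = r i" if "i \<in> {1..k}" for i
      using part cP that by simp
  qed
qed

theorem theorem14:
  fixes G :: "'a pair_pre_digraph" and r :: "nat \<Rightarrow> nat" and k n :: nat
  assumes "complete_multipartite_digraph k r (with_proj G)"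
    and "\<forall>i\<in>{1..k}. 0 < r i"
    and "n = (\<Sum>i=1..k. r i)"
    and "2 \<le> k" and "k < n"
    and "\<forall>i\<in>{1..k}. \<forall>j\<in>{1..k}. i \<le> j \<longrightarrow> r j \<le> r i"
  shows "gp_number (with_proj (mycielskian G)) = max n (2 * r 1)"
proof -
  from complete_multipartite_digraphE[OF assms(1,2)] obtain c where
    cm: "complete_multipartite G c" and cV: "c ` pverts G = {1..k}"
    and V: "card (pverts G) = (\<Sum>i=1..k. r i)"
    and part: "\<And>i. i \<in> {1..k} \<Longrightarrow> card {u \<in> pverts G. c u = i} = r i" by blast
  interpret complete_multipartite G c by fact
  have r1: "r i \<le> r 1" if "i \<in> {1..k}" for i using assms(6) that by auto
  have p1: "card {u \<in> pverts G. c u = 1} = r 1" using part assms(4) by simp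
  have "card {u \<in> pverts G. c u = j} \<le> r 1" for j
  proof (cases "j \<in> {1..k}")
    case True
    then show ?thesis using part r1 by simp
  next
    case False
    then have "{u \<in> pverts G. c u = j} = {}" using cV by blast
    then show ?thesis by (simp only: card.empty le0)
  qed
  moreover have "2 \<le> r 1"
  proof (rule ccontr)
    assume "\<not> 2 \<le> r 1"
    then have "(\<Sum>i=1..k. r i) \<le> (\<Sum>i=1..k. 1)" using r1 by (intro sum_mono) fastforce
    then show False using assms(3,5) by simp
  qed
  ultimately show ?thesis
    using gp_number_mycielskian[of 1] p1 V cV assms(3,4,5) by simp
qed

end
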